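(* Consider a family of average-reward Markov decision processes with finite state space $\mathsf{X}$, $|\mathsf X|=d$, action space $\mathsf{U}$ an open subset of $\mathbb{R}^m$, non-empty open sets of feasible inputs $\mathsf{U}(x)\subset\mathsf{U}$, controlled transition matrix $P_u(x,x')$, and one-step reward $w_\zeta(x,u)$, $\zeta\in\mathbb{R}$, continuously differentiable in $\zeta$, with $W_\zeta(x,u)=\frac{d}{d\zeta}w_\zeta(x,u)$. Fix a state $x^\circ\in\mathsf{X}$. Assume: (A1) For each $\zeta\in\mathbb{R}$ there is a solution $(h^*_\zeta,\eta^*_\zeta)$, $h^*_\zeta:\mathsf{X}\to\mathbb{R}$, $\eta^*_\zeta\in\mathbb{R}$, to the average reward optimality equation $$\max_{u\in\mathsf{U}(x)}\Bigl\{w_\zeta(x,u)+\sum_{x'}P_u(x,x')h^*_\zeta(x')\Bigr\}=h^*_\zeta(x)+\eta^*_\zeta,\qquad x\in\mathsf{X},$$ with $h^*_\zeta(x^\circ)=0$, and the pair $(h^*_\zeta,\eta^*_\zeta)$ is continuously differentiable in $\zeta$. Moreover the function $q^*_\zeta(x,u)=w_\zeta(x,u)+P_uh^*_\zeta\,(x)$ is jointly continuously differentiable in $(\zeta,u)$, with $$\frac{d}{d\zeta}q^*_\zeta(x,u)=W_\zeta(x,u)+P_uH^*_\zeta\,(x),\qquad H^*_\zeta(x)=\frac{d}{d\zeta}h^*_\zeta(x).$$ (A2) The stationary policy exists as the maximizer $\phi^*_\zeta(x)=\arg\max_{u\in\mathsf{U}(x)}q^*_\zeta(x,u)$, $x\in\mathsf{X}$,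 and is continuously differentiable in $\zeta$ for each $x$. (A3) For each $\zeta$ the optimal transition matrix $\check P_\zeta(x,x')=P_{\phi^*_\zeta(x)}(x,x')$ is irreducible, with unique invariant pmf denoted $\pi_\zeta$. Let $\mathcal{V}$ be the MDP vector field defined in the context. Then: (i) The family of relative value functions $\{h^*_\zeta\}$ is a solution to the ordinary differential equation $$\frac{d}{d\zeta}h^*_\zeta=\mathcal{V}(h^*_\zeta,\zeta).$$ (ii) $\frac{d}{d\zeta}\eta^*_\zeta=\bar w_\zeta$, where $\bar w_\zeta=\sum_x\pi_\zeta(x)W_\zeta(x,\phi^*_\zeta(x))$. (iii) If the derivative $W_\zeta(x,u)$ is independent of $\zeta$ and $u$ for each $x$, then the ODE is homogeneous; that is, for each $h$ (in the domain of $\mathcal{V}$), $\mathcal{V}(h,\zeta)$ does not depend on $\zeta$.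
   Context: For a controlled transition matrix, $P_u(x,x')=\mathsf{P}\{X(t+1)=x'\mid X(t)=x,U(t)=u\}$, and $P_uh\,(x)=\sum_{x'}P_u(x,x')h(x')$ for $h:\mathsf{X}\to\mathbb{R}$; similarly $\check Ph\,(x)=\sum_{x'}\check P(x,x')h(x')$ for an uncontrolled transition matrix. Functions on $\mathsf{X}$ are identified with vectors in $\mathbb{R}^d$. "pmf" means probability mass function. MDP vector field. For a given function $h:\mathsf{X}\to\mathbb{R}$ and $\zeta\in\mathbb{R}$, the function $\mathcal{V}(h,\zeta):\mathsf{X}\to\mathbb{R}$ is defined by the following steps: 1. Obtain a policy $\phi(x)=\arg\max_{u\in\mathsf{U}(x)}\{w_\zeta(x,u)+P_uh\,(x)\}$. 2. Obtain the transition matrix $\check P(x,x')=P_{\phi(x)}(x,x')$, $x,x'\in\mathsf{X}$. 3. Obtain the solution $H$ to Poisson's equation $\check W+\check PH=H+\bar w$, in which $\check W(x)=W_\zeta(x,\phi(x))$ and the constant $\bar w$ is the steady-state mean of $\check W$ under this policy (its mean under the invariant pmf of $\check P$). The solution is normalized so that $H(x^\circ)=0$. 4. Set $\mathcal{V}(h,\zeta)=H$. The domain of $\mathcal{V}$ consists of those $h$ for which steps 1–3 can be carried out. The notation $\phi=\arg\max$ means that the maximizer exists and is unique. *)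

theory Defs
  imports "HOL-Analysis.Analysis" "HOL-Probability.Probability_Mass_Function"
begin

text \<open>
  The finite state space is the type \<open>'x\<close>, so functions on it are vectors in \<open>real ^ 'x\<close>, a controlled
  transition matrix is \<open>P :: real ^ 'm \<Rightarrow> real ^ 'x ^ 'x\<close> with \<open>P u $ x $ x'\<close> the probability of moving
  from \<open>x\<close> to \<open>x'\<close> under input \<open>u\<close>, and \<open>P u *v h\<close> is the function \<open>P\<^sub>u h\<close>.  Only the rows
  \<open>P u $ x\<close> with \<open>u\<close> feasible at \<open>x\<close> carry meaning; likewise for rewards \<open>w \<zeta> x u\<close>.
\<close>

definition prob_vector :: "real ^ 'x::finite \<Rightarrow> bool" where
  "prob_vector p \<longleftrightarrow> (\<forall>x. 0 \<le> p $ x) \<and> (\<Sum>x\<in>UNIV. p $ x) = 1"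

definition mdp_family ::
  "(real ^ 'm::finite) set \<Rightarrow> ('x::finite \<Rightarrow> (real ^ 'm) set) \<Rightarrow> (real ^ 'm \<Rightarrow> real ^ 'x ^ 'x)
    \<Rightarrow> (real \<Rightarrow> 'x \<Rightarrow> real ^ 'm \<Rightarrow> real) \<Rightarrow> bool" where
  "mdp_family U Ux P w \<longleftrightarrow>
     open U \<and>
     (\<forall>x. open (Ux x) \<and> Ux x \<noteq> {} \<and> Ux x \<subseteq> U) \<and>
     (\<forall>x. \<forall>u\<in>Ux x. prob_vector (P u $ x)) \<and>
     (\<forall>x. \<forall>u\<in>Ux x. (\<lambda>\<zeta>. w \<zeta> x u) C1_differentiable_on UNIV)"

definition reward_deriv :: "(real \<Rightarrow> 'x \<Rightarrow> 'u \<Rightarrow> real) \<Rightarrow> real \<Rightarrow> 'x \<Rightarrow> 'u \<Rightarrow> real" where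
  "reward_deriv w \<zeta> x u = deriv (\<lambda>z. w z x u) \<zeta>"

definition qfun ::
  "(real ^ 'm::finite \<Rightarrow> real ^ 'x::finite ^ 'x) \<Rightarrow> (real \<Rightarrow> 'x \<Rightarrow> real ^ 'm \<Rightarrow> real)
    \<Rightarrow> real ^ 'x \<Rightarrow> real \<Rightarrow> 'x \<Rightarrow> real ^ 'm \<Rightarrow> real" where
  "qfun P w h \<zeta> x u = w \<zeta> x u + (P u *v h) $ x"

definition is_max_value :: "('a \<Rightarrow> real) \<Rightarrow> 'a set \<Rightarrow> real \<Rightarrow> bool" where
  "is_max_value f S c \<longleftrightarrow> (\<exists>u\<in>S. f u = c) \<and> (\<forall>u\<in>S. f u \<le> c)"

definition has_unique_arg_max :: "('a \<Rightarrow> real) \<Rightarrow> 'a set \<Rightarrow> bool" where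
  "has_unique_arg_max f S \<longleftrightarrow> (\<exists>!u. is_arg_max f (\<lambda>v. v \<in> S) u)"

text \<open>Continuous (Frechet) differentiability, intended for open \<open>S\<close>.\<close>

definition jointly_C1_on ::
  "('a::real_normed_vector \<Rightarrow> 'b::real_normed_vector) \<Rightarrow> 'a set \<Rightarrow> bool" where
  "jointly_C1_on f S \<longleftrightarrow>
     (\<exists>D. (\<forall>p\<in>S. (f has_derivative blinfun_apply (D p)) (at p)) \<and> continuous_on S D)"

definition closed_loop ::
  "(real ^ 'm::finite \<Rightarrow> real ^ 'x::finite ^ 'x) \<Rightarrow> ('x \<Rightarrow> real ^ 'm) \<Rightarrow> real ^ 'x ^ 'x" where
  "closed_loop P \<phi> = (\<chi> x x'. P (\<phi> x) $ x $ x')"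

text \<open>Matrix powers are iterates of \<open>**\<close>: the operation \<open>^\<close> on this type is componentwise.\<close>

definition irreducible_matrix :: "real ^ 'x::finite ^ 'x \<Rightarrow> bool" where
  "irreducible_matrix A \<longleftrightarrow> (\<forall>x x'. \<exists>n\<ge>1. (((**) A ^^ n) (mat 1)) $ x $ x' > 0)"

definition invariant_pmf :: "real ^ 'x::finite ^ 'x \<Rightarrow> 'x pmf \<Rightarrow> bool" where
  "invariant_pmf A \<pi> \<longleftrightarrow> (\<chi> x. pmf \<pi> x) v* A = (\<chi> x. pmf \<pi> x)"

definition pmf_mean :: "'x::finite pmf \<Rightarrow> real ^ 'x \<Rightarrow> real" where
  "pmf_mean \<pi> f = (\<Sum>x\<in>UNIV. pmf \<pi> x * f $ x)"

text \<open>Here \<open>vec c\<close> is the constant function.\<close>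

definition normalized_poisson ::
  "real ^ 'x::finite ^ 'x \<Rightarrow> real ^ 'x \<Rightarrow> real \<Rightarrow> 'x \<Rightarrow> real ^ 'x \<Rightarrow> bool" where
  "normalized_poisson A f c x0 H \<longleftrightarrow> f + A *v H = H + vec c \<and> H $ x0 = 0"

definition mdp_policy ::
  "('x::finite \<Rightarrow> (real ^ 'm::finite) set) \<Rightarrow> (real ^ 'm \<Rightarrow> real ^ 'x ^ 'x)
    \<Rightarrow> (real \<Rightarrow> 'x \<Rightarrow> real ^ 'm \<Rightarrow> real) \<Rightarrow> real ^ 'x \<Rightarrow> real \<Rightarrow> 'x \<Rightarrow> real ^ 'm" where
  "mdp_policy Ux P w h \<zeta> x = arg_max_on (qfun P w h \<zeta> x) (Ux x)"

definition mdp_matrix ::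
  "('x::finite \<Rightarrow> (real ^ 'm::finite) set) \<Rightarrow> (real ^ 'm \<Rightarrow> real ^ 'x ^ 'x)
    \<Rightarrow> (real \<Rightarrow> 'x \<Rightarrow> real ^ 'm \<Rightarrow> real) \<Rightarrow> real ^ 'x \<Rightarrow> real \<Rightarrow> real ^ 'x ^ 'x" where
  "mdp_matrix Ux P w h \<zeta> = closed_loop P (mdp_policy Ux P w h \<zeta>)"

definition mdp_forcing ::
  "('x::finite \<Rightarrow> (real ^ 'm::finite) set) \<Rightarrow> (real ^ 'm \<Rightarrow> real ^ 'x ^ 'x)
    \<Rightarrow> (real \<Rightarrow> 'x \<Rightarrow> real ^ 'm \<Rightarrow> real) \<Rightarrow> real ^ 'x \<Rightarrow> real \<Rightarrow> real ^ 'x" where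
  "mdp_forcing Ux P w h \<zeta> = (\<chi> x. reward_deriv w \<zeta> x (mdp_policy Ux P w h \<zeta> x))"

definition mdp_mean ::
  "('x::finite \<Rightarrow> (real ^ 'm::finite) set) \<Rightarrow> (real ^ 'm \<Rightarrow> real ^ 'x ^ 'x)
    \<Rightarrow> (real \<Rightarrow> 'x \<Rightarrow> real ^ 'm \<Rightarrow> real) \<Rightarrow> real ^ 'x \<Rightarrow> real \<Rightarrow> real" where
  "mdp_mean Ux P w h \<zeta> =
     pmf_mean (THE \<pi>. invariant_pmf (mdp_matrix Ux P w h \<zeta>) \<pi>) (mdp_forcing Ux P w h \<zeta>)"

text \<open>
  The vector field is partial.  \<open>mdp_field\<close> is its value, to be used only where \<open>mdp_field_dom\<close> holds;
  the latter says that every object described in the construction by a definite article (maximizer,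
  invariant pmf, normalized solution) exists and is unique.
\<close>

definition mdp_field_dom ::
  "('x::finite \<Rightarrow> (real ^ 'm::finite) set) \<Rightarrow> (real ^ 'm \<Rightarrow> real ^ 'x ^ 'x)
    \<Rightarrow> (real \<Rightarrow> 'x \<Rightarrow> real ^ 'm \<Rightarrow> real) \<Rightarrow> 'x \<Rightarrow> real ^ 'x \<Rightarrow> real \<Rightarrow> bool" where
  "mdp_field_dom Ux P w x0 h \<zeta> \<longleftrightarrow>
     (\<forall>x. has_unique_arg_max (qfun P w h \<zeta> x) (Ux x)) \<and>
     (\<exists>!\<pi>. invariant_pmf (mdp_matrix Ux P w h \<zeta>) \<pi>) \<and>
     (\<exists>!H. normalized_poisson (mdp_matrix Ux P w h \<zeta>) (mdp_forcing Ux P w h \<zeta>)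
             (mdp_mean Ux P w h \<zeta>) x0 H)"

definition mdp_field ::
  "('x::finite \<Rightarrow> (real ^ 'm::finite) set) \<Rightarrow> (real ^ 'm \<Rightarrow> real ^ 'x ^ 'x)
    \<Rightarrow> (real \<Rightarrow> 'x \<Rightarrow> real ^ 'm \<Rightarrow> real) \<Rightarrow> 'x \<Rightarrow> real ^ 'x \<Rightarrow> real \<Rightarrow> real ^ 'x" where
  "mdp_field Ux P w x0 h \<zeta> =
     (THE H. normalized_poisson (mdp_matrix Ux P w h \<zeta>) (mdp_forcing Ux P w h \<zeta>)
               (mdp_mean Ux P w h \<zeta>) x0 H)"

end

theory Submission
  imports Defs
begin

text \<open>
  The gap \<open>h\<^sub>z(x) + \<eta>\<^sub>z - q\<^sub>z(x, u)\<close>, with \<open>u = \<phi>\<^sub>\<zeta>(x)\<close> frozen, is nonnegative and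
  vanishes at \<open>z = \<zeta>\<close>, so its derivative there is zero (envelope theorem): this is Poisson's equation
  for \<open>H\<^sub>\<zeta>\<close> with constant \<open>\<eta>'(\<zeta>)\<close>.  Averaging it under the invariant pmf identifies the constant, and the
  maximum principle for irreducible matrices identifies the solution.  If the reward derivative is
  independent of \<open>\<zeta>\<close> and \<open>u\<close>, changing \<open>\<zeta>\<close> shifts the maximand by a constant.
\<close>

section \<open>Stochastic matrices and the maximum principle\<close>

lemma matrix_power_prob_vector:
  fixes A :: "real ^ 'x::finite ^ 'x"
  assumes "\<And>x. prob_vector (A $ x)"
  shows "prob_vector ((((**) A ^^ n) (mat 1)) $ x)"
proof (induction n arbitrary: x)
  case 0
  show ?case by (simp add: prob_vector_def mat_def)
next
  case (Suc n)
  define B where "B = ((**) A ^^ n) (mat 1)"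
  have B: "0 \<le> B $ k $ y" "(\<Sum>y\<in>UNIV. B $ k $ y) = 1" for k y
    using Suc.IH by (auto simp: prob_vector_def B_def)
  have A: "0 \<le> A $ k $ y" "(\<Sum>y\<in>UNIV. A $ k $ y) = 1" for k y
    using assms by (auto simp: prob_vector_def)
  \<comment> \<open>After the swap the inner sums are row sums of \<open>B\<close>, so what remains
    is a row sum of \<open>A\<close>.\<close>
  have "(\<Sum>y\<in>UNIV. \<Sum>k\<in>UNIV. A $ x $ k * B $ k $ y)
      = (\<Sum>k\<in>UNIV. A $ x $ k * (\<Sum>y\<in>UNIV. B $ k $ y))"
    by (subst sum.swap) (simp add: sum_distrib_left)
  then have "prob_vector ((A ** B) $ x)"
    by (simp add: prob_vector_def matrix_matrix_mult_def A B sum_nonneg)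
  then show ?case by (simp add: B_def)
qed

lemma matrix_power_fixed_vector:
  fixes A :: "real ^ 'x::finite ^ 'x"
  assumes "A *v D = D"
  shows "((**) A ^^ n) (mat 1) *v D = D"
  by (induction n) (simp_all add: assms flip: matrix_vector_mul_assoc)

text \<open>The terms \<open>p $ y * (M - D $ y)\<close> are nonnegative and sum to
  \<open>M - M = 0\<close>, so each of them vanishes; division by \<open>p $ x > 0\<close> gives the
  claim.\<close>

lemma prob_vector_average_max:
  fixes p D :: "real ^ 'x::finite"
  assumes p: "prob_vector p" and avg: "(\<Sum>y\<in>UNIV. p $ y * D $ y) = M"
    and le: "\<And>y. D $ y \<le> M" and pos: "0 < p $ x"
  shows "D $ x = M"
proof -
  have p': "0 \<le> p $ y" "(\<Sum>y\<in>UNIV. p $ y) = 1" for y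
    using p by (auto simp: prob_vector_def)
  have "(\<Sum>y\<in>UNIV. p $ y * (M - D $ y)) = 0"
    by (simp add: right_diff_distrib sum_subtractf avg p' flip: sum_distrib_right)
  then have "p $ x * (M - D $ x) = 0"
    by (subst (asm) sum_nonneg_eq_0_iff) (auto simp: p' le)
  with pos show ?thesis by simp
qed

text \<open>At a state \<open>m\<close> where \<open>D\<close> attains its maximum, the maximum is
  the average of \<open>D\<close> under row \<open>m\<close> of every power of \<open>A\<close>. By
  irreducibility each state is charged by row \<open>m\<close> of some power, so \<open>D\<close> is
  maximal there too.\<close>

lemma irreducible_fixed_vector_const:
  fixes A :: "real ^ 'x::finite ^ 'x"
  assumes A: "\<And>x. prob_vector (A $ x)" and irr: "irreducible_matrix A" and fix_D: "A *v D = D"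
  shows "D $ x = D $ y"
proof -
  define M where "M = Max (range (($) D))"
  have le: "D $ z \<le> M" for z by (simp add: M_def)
  have "M \<in> range (($) D)" unfolding M_def by (intro Max_in) auto
  then obtain m where m: "D $ m = M" by auto
  have "D $ z = M" for z
  proof -
    obtain n where n: "0 < (((**) A ^^ n) (mat 1)) $ m $ z"
      using irr by (auto simp: irreducible_matrix_def)
    have "(((**) A ^^ n) (mat 1) *v D) $ m = M"
      by (simp only: matrix_power_fixed_vector[OF fix_D] m)
    then have "(\<Sum>k\<in>UNIV. (((**) A ^^ n) (mat 1)) $ m $ k * D $ k) = M"
      by (simp add: matrix_vector_mult_def)
    then show ?thesis
      by (rule prob_vector_average_max[OF matrix_power_prob_vector[OF A] _ le n])
  qed
  then show ?thesis by simp
qed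

section \<open>Poisson's equation: uniqueness of the solution and of the constant\<close>

lemma normalized_poisson_unique:
  assumes A: "\<And>x. prob_vector (A $ x)" "irreducible_matrix A"
    and H: "normalized_poisson A f c x0 H" and G: "normalized_poisson A f c x0 G"
  shows "H = G"
proof -
  \<comment> \<open>Subtraction removes \<open>f\<close> and the constant, so \<open>H - G\<close>
    is fixed by \<open>A\<close>, hence constant, and it is zero at \<open>x0\<close>.\<close>
  have "f + A *v H - (f + A *v G) = H + vec c - (G + vec c)"
    using H G by (simp add: normalized_poisson_def)
  then have "A *v (H - G) = H - G"
    by (simp add: matrix_vector_mult_diff_distrib)
  then have "(H - G) $ x = (H - G) $ x0" for x
    by (rule irreducible_fixed_vector_const[OF A])
  with H G show ?thesis
    by (simp add: normalized_poisson_def vec_eq_iff)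
qed

lemma pmf_mean_eq_inner: "pmf_mean \<mu> f = (\<chi> x. pmf \<mu> x) \<bullet> f"
  by (simp add: pmf_mean_def inner_vec_def)

text \<open>Pair the equation with the invariant pmf: invariance moves \<open>A\<close> off
  \<open>H\<close>, the two terms in \<open>H\<close> cancel, and total mass one leaves
  \<open>c\<close>.\<close>

lemma normalized_poisson_const:
  assumes inv: "invariant_pmf A \<mu>" and H: "normalized_poisson A f c x0 H"
  shows "c = pmf_mean \<mu> f"
proof -
  let ?p = "\<chi> x. pmf \<mu> x"
  have "?p \<bullet> (A *v H) = ?p \<bullet> H"
    using inv dot_lmul_matrix[of ?p A H] by (simp add: invariant_pmf_def)
  moreover have "?p \<bullet> vec c = c"
    by (simp add: inner_vec_def sum_pmf_eq_1 flip: sum_distrib_right)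
  moreover have "?p \<bullet> (f + A *v H) = ?p \<bullet> (H + vec c)"
    using H by (simp add: normalized_poisson_def)
  ultimately show ?thesis
    by (simp add: pmf_mean_eq_inner inner_add_right)
qed

section \<open>Maximizers and feasible policies\<close>

lemma has_unique_arg_max_imp_arg_max_on:
  assumes "has_unique_arg_max f S"
  shows "arg_max_on f S \<in> S" and "u \<in> S \<Longrightarrow> f u \<le> f (arg_max_on f S)"
proof -
  \<comment> \<open>\<open>arg_max_on\<close> is a Hilbert choice, so it is a maximizer only once
    existence is known.\<close>
  have "is_arg_max f (\<lambda>v. v \<in> S) (arg_max_on f S)"
    using assms unfolding has_unique_arg_max_def arg_max_on_def arg_max_def
    by (metis someI_ex)
  then show "arg_max_on f S \<in> S" and "u \<in> S \<Longrightarrow> f u \<le> f (arg_max_on f S)"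
    by (auto simp: is_arg_max_def not_less)
qed

text \<open>Stated as equality of predicates, because \<open>arg_max_on\<close> and
  \<open>has_unique_arg_max\<close> depend on the objective only through this predicate; both then
  transfer by rewriting.\<close>

lemma is_arg_max_shift:
  fixes f g :: "'a \<Rightarrow> real"
  assumes "\<And>u. u \<in> S \<Longrightarrow> g u = f u + k"
  shows "is_arg_max g (\<lambda>v. v \<in> S) = is_arg_max f (\<lambda>v. v \<in> S)"
  using assms by (auto simp: is_arg_max_def fun_eq_iff)

lemma closed_loop_prob_vector:
  assumes "mdp_family U Ux P w" and "\<And>x. \<psi> x \<in> Ux x"
  shows "prob_vector (closed_loop P \<psi> $ x)"
proof -
  have "closed_loop P \<psi> $ x = P (\<psi> x) $ x"
    by (simp add: closed_loop_def vec_eq_iff)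
  with assms show ?thesis by (simp add: mdp_family_def)
qed

lemma closed_loop_mult_component:
  "(closed_loop P \<psi> *v H) $ x = (P (\<psi> x) *v H) $ x"
  by (simp add: closed_loop_def matrix_vector_mult_def)

section \<open>Homogeneity in the parameter\<close>

lemma reward_affine:
  assumes mdp: "mdp_family U Ux P w" and u: "u \<in> Ux x"
    and c: "\<And>\<zeta>. reward_deriv w \<zeta> x u = c"
  shows "w \<zeta>' x u = w \<zeta> x u + (\<zeta>' - \<zeta>) * c"
proof -
  have "(\<lambda>z. w z x u) differentiable at z" for z
    using mdp u by (auto simp: mdp_family_def C1_differentiable_on_eq)
  then have "((\<lambda>z. w z x u) has_real_derivative c) (at z)" for z
    using c[of z] by (metis DERIV_deriv_iff_real_differentiable reward_deriv_def)
  \<comment> \<open>Removing the linear part leaves a function with zero derivative on the whole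
    line, hence a constant.\<close>
  then have "((\<lambda>z. w z x u - z * c) has_real_derivative 0) (at z)" for z
    by (auto intro!: derivative_eq_intros)
  then have "w \<zeta>' x u - \<zeta>' * c = w \<zeta> x u - \<zeta> * c"
    by (intro DERIV_isconst_all) auto
  then show ?thesis by (simp add: algebra_simps)
qed

text \<open>The shift \<open>(\<zeta>' - \<zeta>) * c x\<close> of the maximand does not depend on
  the input, so policy, matrix, forcing and mean all agree at the two parameters; domain and value
  are built from these.\<close>

lemma homogeneous_mdp_field:
  assumes mdp: "mdp_family U Ux P w"
    and c: "\<And>x \<zeta> u. u \<in> Ux x \<Longrightarrow> reward_deriv w \<zeta> x u = c x"
    and dom: "mdp_field_dom Ux P w x0 g \<zeta>"
  shows "mdp_field_dom Ux P w x0 g \<zeta>'" and "mdp_field Ux P w x0 g \<zeta>' = mdp_field Ux P w x0 g \<zeta>"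
proof -
  have arg: "is_arg_max (qfun P w g \<zeta>' x) (\<lambda>v. v \<in> Ux x) = is_arg_max (qfun P w g \<zeta> x) (\<lambda>v. v \<in> Ux x)"
    for x
  proof (rule is_arg_max_shift)
    fix u assume u: "u \<in> Ux x"
    from reward_affine[OF mdp u c[OF u], of \<zeta>' \<zeta>]
    show "qfun P w g \<zeta>' x u = qfun P w g \<zeta> x u + (\<zeta>' - \<zeta>) * c x"
      by (simp add: qfun_def)
  qed
  then have policy: "mdp_policy Ux P w g \<zeta>' = mdp_policy Ux P w g \<zeta>"
    by (simp add: fun_eq_iff mdp_policy_def arg_max_on_def arg_max_def)
  have uniq: "has_unique_arg_max (qfun P w g \<zeta>' x) (Ux x) = has_unique_arg_max (qfun P w g \<zeta> x) (Ux x)"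
    for x by (simp add: has_unique_arg_max_def arg)
  \<comment> \<open>The constant \<open>c x\<close> describes the reward derivative at feasible
    inputs only, so feasibility must come from the domain condition.\<close>
  have "mdp_policy Ux P w g \<zeta> x \<in> Ux x" for x
    using dom has_unique_arg_max_imp_arg_max_on(1) by (auto simp: mdp_field_dom_def mdp_policy_def)
  then have forcing: "mdp_forcing Ux P w g \<zeta>' = mdp_forcing Ux P w g \<zeta>"
    by (simp add: mdp_forcing_def policy c vec_eq_iff)
  have matrix: "mdp_matrix Ux P w g \<zeta>' = mdp_matrix Ux P w g \<zeta>"
    by (simp add: mdp_matrix_def policy)
  have mean: "mdp_mean Ux P w g \<zeta>' = mdp_mean Ux P w g \<zeta>"
    by (simp add: mdp_mean_def matrix forcing)
  show "mdp_field_dom Ux P w x0 g \<zeta>'"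
    using dom by (simp add: mdp_field_dom_def uniq matrix forcing mean)
  show "mdp_field Ux P w x0 g \<zeta>' = mdp_field Ux P w x0 g \<zeta>"
    by (simp add: mdp_field_def matrix forcing mean)
qed

theorem theorem2p2:
  fixes U :: "(real ^ 'm::finite) set"
    and Ux :: "'x::finite \<Rightarrow> (real ^ 'm) set"
    and P :: "real ^ 'm \<Rightarrow> real ^ 'x ^ 'x"
    and w :: "real \<Rightarrow> 'x \<Rightarrow> real ^ 'm \<Rightarrow> real"
    and x0 :: 'x
    and h :: "real \<Rightarrow> real ^ 'x"
    and \<eta> :: "real \<Rightarrow> real"
    and \<phi> :: "real \<Rightarrow> 'x \<Rightarrow> real ^ 'm"
    and \<pi> :: "real \<Rightarrow> 'x pmf"
  assumes mdp: "mdp_family U Ux P w"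
    and A1_opt: "\<And>\<zeta> x. is_max_value (\<lambda>u. w \<zeta> x u + (P u *v h \<zeta>) $ x) (Ux x) (h \<zeta> $ x + \<eta> \<zeta>)"
    and A1_norm: "\<And>\<zeta>. h \<zeta> $ x0 = 0"
    and A1_C1: "(\<lambda>\<zeta>. (h \<zeta>, \<eta> \<zeta>)) C1_differentiable_on UNIV"
    and A1_q_C1: "\<And>x. jointly_C1_on (\<lambda>(\<zeta>, u). qfun P w (h \<zeta>) \<zeta> x u) (UNIV \<times> Ux x)"
    and A1_q_deriv: "\<And>\<zeta> x u. u \<in> Ux x \<Longrightarrow>
          ((\<lambda>z. qfun P w (h z) z x u) has_real_derivative
             reward_deriv w \<zeta> x u + (P u *v vector_derivative h (at \<zeta>)) $ x) (at \<zeta>)"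
    and A2_unique: "\<And>\<zeta> x. has_unique_arg_max (qfun P w (h \<zeta>) \<zeta> x) (Ux x)"
    and A2_policy: "\<And>\<zeta> x. \<phi> \<zeta> x = arg_max_on (qfun P w (h \<zeta>) \<zeta> x) (Ux x)"
    and A2_C1: "\<And>x. (\<lambda>\<zeta>. \<phi> \<zeta> x) C1_differentiable_on UNIV"
    and A3_irred: "\<And>\<zeta>. irreducible_matrix (closed_loop P (\<phi> \<zeta>))"
    and A3_inv: "\<And>\<zeta>. invariant_pmf (closed_loop P (\<phi> \<zeta>)) (\<pi> \<zeta>)"
    and A3_unique: "\<And>\<zeta> \<mu>. invariant_pmf (closed_loop P (\<phi> \<zeta>)) \<mu> \<Longrightarrow> \<mu> = \<pi> \<zeta>"
  shows
    "(\<forall>\<zeta>. mdp_field_dom Ux P w x0 (h \<zeta>) \<zeta> \<and>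
          (h has_vector_derivative mdp_field Ux P w x0 (h \<zeta>) \<zeta>) (at \<zeta>)) \<and>
     (\<forall>\<zeta>. (\<eta> has_real_derivative
             (\<Sum>x\<in>UNIV. pmf (\<pi> \<zeta>) x * reward_deriv w \<zeta> x (\<phi> \<zeta> x))) (at \<zeta>)) \<and>
     ((\<forall>x. \<exists>c. \<forall>\<zeta>. \<forall>u\<in>Ux x. reward_deriv w \<zeta> x u = c) \<longrightarrow>
        (\<forall>g \<zeta> \<zeta>'. mdp_field_dom Ux P w x0 g \<zeta> \<longrightarrow>
           mdp_field_dom Ux P w x0 g \<zeta>' \<and>
           mdp_field Ux P w x0 g \<zeta>' = mdp_field Ux P w x0 g \<zeta>))"
proof (intro conjI allI impI)
  fix \<zeta>
  have policy: "mdp_policy Ux P w (h \<zeta>) \<zeta> = \<phi> \<zeta>"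
    by (simp add: fun_eq_iff mdp_policy_def A2_policy)
  have matrix: "mdp_matrix Ux P w (h \<zeta>) \<zeta> = closed_loop P (\<phi> \<zeta>)"
    by (simp add: mdp_matrix_def policy)
  have THE_inv: "(THE \<mu>. invariant_pmf (closed_loop P (\<phi> \<zeta>)) \<mu>) = \<pi> \<zeta>"
    using A3_inv A3_unique by blast
  have feas: "\<phi> \<zeta> x \<in> Ux x" for x
    using has_unique_arg_max_imp_arg_max_on(1)[OF A2_unique] by (simp add: A2_policy)
  have value_le: "qfun P w (h z) z x u \<le> h z $ x + \<eta> z" if "u \<in> Ux x" for z x u
    using A1_opt[where \<zeta> = z and x = x] that by (auto simp: is_max_value_def qfun_def)
  \<comment> \<open>(A1) provides some input attaining the maximum; the maximizer
    \<open>\<phi> \<zeta> x\<close> does at least as well, and by \<open>value_le\<close> no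
    better.\<close>
  have value_eq: "qfun P w (h \<zeta>) \<zeta> x (\<phi> \<zeta> x) = h \<zeta> $ x + \<eta> \<zeta>" for x
  proof -
    obtain u where "u \<in> Ux x" "qfun P w (h \<zeta>) \<zeta> x u = h \<zeta> $ x + \<eta> \<zeta>"
      using A1_opt[where \<zeta> = \<zeta> and x = x] by (auto simp: is_max_value_def qfun_def)
    with has_unique_arg_max_imp_arg_max_on(2)[OF A2_unique] value_le[OF feas] show ?thesis
      by (metis A2_policy order.antisym)
  qed
  define H where "H = vector_derivative h (at \<zeta>)"
  have "(\<lambda>\<zeta>. (h \<zeta>, \<eta> \<zeta>)) differentiable at \<zeta>"
    using A1_C1 by (simp add: C1_differentiable_on_eq)
  then obtain D where D: "((\<lambda>\<zeta>. (h \<zeta>, \<eta> \<zeta>)) has_derivative D) (at \<zeta>)"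
    by (auto simp: differentiable_def)
  have "h differentiable at \<zeta>" "\<eta> differentiable at \<zeta>"
    using has_derivative_fst[OF D] has_derivative_snd[OF D] by (auto simp: differentiable_def)
  then have h': "(h has_vector_derivative H) (at \<zeta>)"
    and \<eta>': "(\<eta> has_real_derivative deriv \<eta> \<zeta>) (at \<zeta>)"
    by (simp_all add: H_def vector_derivative_works DERIV_deriv_iff_real_differentiable)
  have hx': "((\<lambda>z. h z $ x) has_real_derivative H $ x) (at \<zeta>)" for x
    using bounded_linear.has_vector_derivative[OF bounded_linear_vec_nth h']
    by (simp add: has_real_derivative_iff_has_vector_derivative)
  \<comment> \<open>The component of \<open>h\<close> at \<open>x0\<close> is identically zero in
    the parameter, so its derivative is zero.\<close>
  have norm: "H $ x0 = 0"
    using hx'[of x0] by (simp add: A1_norm) (metis DERIV_const DERIV_unique)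
  have poisson_x: "H $ x + deriv \<eta> \<zeta> = reward_deriv w \<zeta> x (\<phi> \<zeta> x) + (P (\<phi> \<zeta> x) *v H) $ x" for x
  proof -
    \<comment> \<open>With the input held fixed, the derivative of the policy never enters and
      \<open>A1_q_deriv\<close> applies directly.\<close>
    let ?gap = "\<lambda>z. h z $ x + \<eta> z - qfun P w (h z) z x (\<phi> \<zeta> x)"
    have "(?gap has_real_derivative
        H $ x + deriv \<eta> \<zeta> - (reward_deriv w \<zeta> x (\<phi> \<zeta> x) + (P (\<phi> \<zeta> x) *v H) $ x)) (at \<zeta>)"
      unfolding H_def using hx'[of x, unfolded H_def] \<eta>' A1_q_deriv[OF feas]
      by (intro DERIV_diff DERIV_add)
    \<comment> \<open>The minimum at \<zeta> is global; the radius 1 is an arbitrary choice.\<close>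
    moreover have "\<forall>z. \<bar>\<zeta> - z\<bar> < 1 \<longrightarrow> ?gap \<zeta> \<le> ?gap z"
      using value_le[OF feas] by (simp add: value_eq)
    ultimately have "H $ x + deriv \<eta> \<zeta> - (reward_deriv w \<zeta> x (\<phi> \<zeta> x) + (P (\<phi> \<zeta> x) *v H) $ x) = 0"
      by (intro DERIV_local_min[of ?gap _ \<zeta> 1]) simp_all
    then show ?thesis by simp
  qed
  have poisson: "normalized_poisson (closed_loop P (\<phi> \<zeta>)) (mdp_forcing Ux P w (h \<zeta>) \<zeta>) (deriv \<eta> \<zeta>) x0 H"
    using poisson_x norm
    by (simp add: normalized_poisson_def vec_eq_iff closed_loop_mult_component mdp_forcing_def policy)
  have mean: "deriv \<eta> \<zeta> = pmf_mean (\<pi> \<zeta>) (mdp_forcing Ux P w (h \<zeta>) \<zeta>)"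
    using normalized_poisson_const[OF A3_inv poisson] .
  \<comment> \<open>The constant in the definition of the vector field is thus the one for which
    \<open>H\<close> solves Poisson's equation.\<close>
  then have mdp_mean: "mdp_mean Ux P w (h \<zeta>) \<zeta> = deriv \<eta> \<zeta>"
    by (simp add: mdp_mean_def matrix THE_inv)
  \<comment> \<open>Irreducibility enters here; the result serves both the domain condition and the
    evaluation of the definite description in \<open>mdp_field\<close>.\<close>
  have unique: "G = H"
    if "normalized_poisson (closed_loop P (\<phi> \<zeta>)) (mdp_forcing Ux P w (h \<zeta>) \<zeta>) (deriv \<eta> \<zeta>) x0 G" for G
    using normalized_poisson_unique[OF closed_loop_prob_vector[OF mdp feas] A3_irred that poisson] .
  show "mdp_field_dom Ux P w x0 (h \<zeta>) \<zeta>"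
    unfolding mdp_field_dom_def matrix mdp_mean
    using A2_unique A3_inv A3_unique poisson unique by blast
  have "mdp_field Ux P w x0 (h \<zeta>) \<zeta> = H"
    unfolding mdp_field_def matrix mdp_mean using poisson unique by blast
  with h' show "(h has_vector_derivative mdp_field Ux P w x0 (h \<zeta>) \<zeta>) (at \<zeta>)"
    by simp
  show "(\<eta> has_real_derivative
      (\<Sum>x\<in>UNIV. pmf (\<pi> \<zeta>) x * reward_deriv w \<zeta> x (\<phi> \<zeta> x))) (at \<zeta>)"
    using \<eta>' by (simp add: mean pmf_mean_def mdp_forcing_def policy)
next
  fix g \<zeta> \<zeta>'
  assume "\<forall>x. \<exists>c. \<forall>\<zeta>. \<forall>u\<in>Ux x. reward_deriv w \<zeta> x u = c"
  then obtain c where c: "\<And>x \<zeta> u. u \<in> Ux x \<Longrightarrow> reward_deriv w \<zeta> x u = c x"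
    by metis
  assume dom: "mdp_field_dom Ux P w x0 g \<zeta>"
  show "mdp_field_dom Ux P w x0 g \<zeta>'"
    by (rule homogeneous_mdp_field(1)[OF mdp c dom])
  show "mdp_field Ux P w x0 g \<zeta>' = mdp_field Ux P w x0 g \<zeta>"
    by (rule homogeneous_mdp_field(2)[OF mdp c dom])
qed

end
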